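(* If $G$ is a connected $(P_3+P_1)$-free graph, then every vertex of $G$ of degree at least $\Delta(G)-1$ is a Gallai vertex.
   Context: All graphs are finite and simple. $P_n$ is the path on $n$ vertices, $G+H$ denotes the disjoint union of graphs $G$ and $H$, and a graph is $F$-free if it has no induced subgraph isomorphic to $F$. $\Delta(G)$ is the maximum degree of $G$. A vertex $v$ of a graph $G$ is a Gallai vertex if every longest path in $G$ contains $v$. *)

theory Defs
  imports
    "Graph_Theory.Digraph_Component"
    "Graph_Theory.Digraph_Isomorphism"
    "Graph_Theory.Vertex_Walk"
begin

text \<open>
  Finite simple graphs are the structures satisfying \<^locale>\<open>graph\<close>: finite, loop-free digraphs
  without parallel arcs whose arc relation is symmetric, each undirected edge being a pair of
  opposite arcs. Hence the number of neighbours of a vertex is its out-degree.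
\<close>

definition degree :: "('a, 'b) pre_digraph \<Rightarrow> 'a \<Rightarrow> nat" where
  "degree G v = out_degree G v"

definition max_degree :: "('a, 'b) pre_digraph \<Rightarrow> nat" where
  "max_degree G = Max (degree G ` verts G)"

definition path_graph :: "nat \<Rightarrow> nat pair_pre_digraph" where
  "path_graph n = \<lparr> pverts = {..<n}, parcs = {(i, j). i < n \<and> j < n \<and> (j = Suc i \<or> i = Suc j)} \<rparr>"

definition disjoint_union :: "'a pair_pre_digraph \<Rightarrow> 'b pair_pre_digraph \<Rightarrow> ('a + 'b) pair_pre_digraph"
where
  "disjoint_union G H = \<lparr> pverts = pverts G <+> pverts H,
     parcs = map_prod Inl Inl ` parcs G \<union> map_prod Inr Inr ` parcs H \<rparr>"

definition induced_free :: "('c, 'd) pre_digraph \<Rightarrow> ('a, 'b) pre_digraph \<Rightarrow> bool" where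
  "induced_free F G \<longleftrightarrow> \<not> (\<exists>H. induced_subgraph H G \<and> digraph_iso H F)"

text \<open>
  A path is given by its sequence of vertices, so each undirected path appears once per orientation.
\<close>

definition longest_path :: "('a, 'b) pre_digraph \<Rightarrow> 'a vwalk \<Rightarrow> bool" where
  "longest_path G p \<longleftrightarrow> vpath p G \<and> (\<forall>q. vpath q G \<longrightarrow> vwalk_length q \<le> vwalk_length p)"

definition gallai_vertex :: "('a, 'b) pre_digraph \<Rightarrow> 'a \<Rightarrow> bool" where
  "gallai_vertex G v \<longleftrightarrow> v \<in> verts G \<and> (\<forall>p. longest_path G p \<longrightarrow> v \<in> set p)"

lemma pair_graph_path_graph: "pair_graph (path_graph n)"
proof
  have "parcs (path_graph n) \<subseteq> {..<n} \<times> {..<n}"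
    by (auto simp: path_graph_def)
  then show "finite (parcs (path_graph n))"
    by (rule finite_subset) simp
qed (auto simp: path_graph_def symmetric_def sym_def)

lemma pair_graph_disjoint_union:
  assumes "pair_graph G" "pair_graph H"
  shows "pair_graph (disjoint_union G H)"
proof -
  interpret G: pair_graph G by fact
  interpret H: pair_graph H by fact
  have "sym (parcs G)" "sym (parcs H)"
    using G.pair_sym_arcs H.pair_sym_arcs by (simp_all add: symmetric_def)
  then show ?thesis
    by unfold_locales
      (auto simp: disjoint_union_def symmetric_def G.pair_finite_verts H.pair_finite_verts
        G.pair_finite_arcs H.pair_finite_arcs
        intro!: symI dest: symD G.in_arcsD1 G.in_arcsD2 H.in_arcsD1 H.in_arcsD2
          G.pair_no_loops H.pair_no_loops)
qed

end

theory Submission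
  imports Defs
begin

text \<open>
  Let p be a longest path that misses v. Exchanging pieces of p against vertices outside p gives
  the classical obstructions: a vertex x outside p that is adjacent to a vertex a of p is adjacent
  neither to the ends of p nor to the successor b of a, and the first vertex h of p is not
  adjacent to b. Thus x, h and b are pairwise non-adjacent (\<open>longest_path_triple\<close>). As a is
  adjacent to both x and b, these three span an induced $P_3$, and excluding $P_3 + P_1$
  forces a to be adjacent to h as well. Now h, a, b span another induced $P_3$, which
  restricts all further vertices outside p (\<open>longest_path_attachment\<close>).

  Two consequences finish the proof. First, connectedness provides some x outside p with a
  neighbour on p, and then v must be adjacent to a or b, since it is not adjacent to the end h;
  so v itself has a neighbour u on p (\<open>neighbour_on_longest_path\<close>). Second, u has at least
  two more neighbours than v (\<open>degree_gap_off_longest_path\<close>): it is adjacent to v, to h, to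
  every neighbour of v outside p, and to the successor of every neighbour of v on p. Hence the
  degree of v is at most the maximum degree minus two.
\<close>

section \<open>Degrees and the forbidden subgraph\<close>

lemma (in graph) dominates_sym: "u \<rightarrow>\<^bsub>G\<^esub> v \<longleftrightarrow> v \<rightarrow>\<^bsub>G\<^esub> u"
  using sym_arcs by (auto intro: arcs_ends_symmetric)

lemma (in graph) degree_conv_card_neighbours: "degree G v = card {u. v \<rightarrow>\<^bsub>G\<^esub> u}"
proof -
  have "bij_betw (head G) (out_arcs G v) {u. v \<rightarrow>\<^bsub>G\<^esub> u}"
    by (rule bij_betw_imageI) (auto simp: arcs_ends_conv arc_to_ends_def intro!: inj_onI no_multi_arcs)
  then show ?thesis
    unfolding degree_def out_degree_def by (rule bij_betw_same_card)
qed

lemma (in graph) finite_neighbours: "finite {u. v \<rightarrow>\<^bsub>G\<^esub> u}"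
  by (rule finite_subset[OF _ finite_verts]) (auto dest: adj_in_verts)

lemma (in graph) degree_le_max_degree: "v \<in> verts G \<Longrightarrow> degree G v \<le> max_degree G"
  unfolding max_degree_def by simp

text \<open>
  This turns the exclusion of induced $P_3 + P_1$ into a statement about adjacency: if it
  failed, then a, b, c, d would induce the forbidden graph.
\<close>

lemma (in graph) induced_P3_dominates:
  assumes free: "induced_free (with_proj (disjoint_union (path_graph 3) (path_graph 1))) G"
    and ab: "a \<rightarrow>\<^bsub>G\<^esub> b" and bc: "b \<rightarrow>\<^bsub>G\<^esub> c" and ac: "\<not> a \<rightarrow>\<^bsub>G\<^esub> c" "a \<noteq> c"
    and d: "d \<in> verts G" "d \<noteq> a" "d \<noteq> b" "d \<noteq> c"
  shows "d \<rightarrow>\<^bsub>G\<^esub> a \<or> d \<rightarrow>\<^bsub>G\<^esub> b \<or> d \<rightarrow>\<^bsub>G\<^esub> c"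
proof (rule ccontr)
  assume "\<not> ?thesis"
  then have nd: "\<not> d \<rightarrow>\<^bsub>G\<^esub> a" "\<not> d \<rightarrow>\<^bsub>G\<^esub> b" "\<not> d \<rightarrow>\<^bsub>G\<^esub> c" "\<not> a \<rightarrow>\<^bsub>G\<^esub> d" "\<not> b \<rightarrow>\<^bsub>G\<^esub> d" "\<not> c \<rightarrow>\<^bsub>G\<^esub> d"
    by (auto simp: dominates_sym)
  have adj: "b \<rightarrow>\<^bsub>G\<^esub> a" "c \<rightarrow>\<^bsub>G\<^esub> b" "\<not> c \<rightarrow>\<^bsub>G\<^esub> a"
    using ab bc ac by (auto simp: dominates_sym)
  have loops: "\<not> a \<rightarrow>\<^bsub>G\<^esub> a" "\<not> b \<rightarrow>\<^bsub>G\<^esub> b" "\<not> c \<rightarrow>\<^bsub>G\<^esub> c" "\<not> d \<rightarrow>\<^bsub>G\<^esub> d"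
    by (auto dest: adj_not_same)
  have ne: "a \<noteq> b" "b \<noteq> c"
    using ab bc loops by auto
  let ?S = "{a, b, c, d}"
  let ?H = "G \<restriction> ?S"
  define \<phi> where "\<phi> = (\<lambda>x. if x = a then Inl 0 else if x = b then Inl 1
    else if x = c then Inl 2 else (Inr 0 :: nat + nat))"
  define f where "f = \<lparr> iso_verts = \<phi>, iso_arcs = (\<lambda>e. (\<phi> (tail G e), \<phi> (head G e))),
    iso_head = snd, iso_tail = fst \<rparr>"
  have S: "?S \<subseteq> verts G"
    using ab bc d by (auto dest: adj_in_verts)
  have inj: "inj_on \<phi> ?S"
    by (auto simp: inj_on_def \<phi>_def)
  have wf: "wf_digraph ?H"
    by (rule wellformed_induce_subgraph)
  \<comment> \<open>An arc is determined by its ends, so the vertex map alone fixes the arc map.\<close>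
  have "inj_on (\<lambda>e. (\<phi> (tail G e), \<phi> (head G e))) (arcs ?H)"
  proof (rule inj_onI)
    fix e e'
    assume e: "e \<in> arcs ?H" "e' \<in> arcs ?H"
      and eq: "(\<phi> (tail G e), \<phi> (head G e)) = (\<phi> (tail G e'), \<phi> (head G e'))"
    have "tail G e = tail G e'" "head G e = head G e'"
      by (rule inj_onD[OF inj]; use e eq in simp)+
    then show "e = e'"
      using e by (intro no_multi_arcs) (simp_all add: arc_to_ends_def)
  qed
  then have "pre_digraph.digraph_isomorphism ?H f"
    using wf inj by (simp add: pre_digraph.digraph_isomorphism_def f_def)
  moreover have "with_proj (disjoint_union (path_graph 3) (path_graph 1)) = app_iso f ?H"
  proof -
    have verts: "\<phi> ` ?S = {..<3} <+> {..<1}"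
      using ne ac d by (auto simp: \<phi>_def Plus_def eval_nat_numeral lessThan_Suc)
    have "(\<lambda>e. (\<phi> (tail G e), \<phi> (head G e))) ` arcs ?H
      = map_prod \<phi> \<phi> ` (arcs_ends G \<inter> ?S \<times> ?S)"
      by (auto simp: arcs_ends_conv image_iff)
    moreover have "arcs_ends G \<inter> ?S \<times> ?S = {(a, b), (b, a), (b, c), (c, b)}"
      using ab bc ac adj loops nd by auto
    ultimately have "iso_arcs f ` arcs ?H
      = {(Inl 0, Inl 1), (Inl 1, Inl 0), (Inl 1, Inl 2), (Inl 2, Inl 1)}"
      using ne ac by (simp add: f_def \<phi>_def)
    moreover have "parcs (disjoint_union (path_graph 3) (path_graph 1))
      = {(Inl 0, Inl 1), (Inl 1, Inl 0), (Inl 1, Inl 2), (Inl 2, Inl 1)}"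
    proof -
      have "parcs (path_graph 3) = {(0, 1), (1, 0), (1, 2), (2, 1)}"
        by (auto simp: path_graph_def)
      moreover have "parcs (path_graph 1) = {}"
        by (auto simp: path_graph_def)
      ultimately show ?thesis
        by (simp add: disjoint_union_def)
    qed
    moreover have "iso_verts f ` verts ?H = pverts (disjoint_union (path_graph 3) (path_graph 1))"
      using verts by (simp add: f_def disjoint_union_def path_graph_def)
    ultimately show ?thesis
      by (simp add: with_proj_def app_iso_def f_def)
  qed
  ultimately have "digraph_iso ?H (with_proj (disjoint_union (path_graph 3) (path_graph 1)))"
    unfolding digraph_iso_def by blast
  with free induced_induce[OF S] show False
    unfolding induced_free_def by blast
qed

section \<open>Vertices outside a longest path\<close>

text \<open>
  Being a chain of adjacent vertices splits over concatenation and reversal, which are the only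
  operations that the exchange arguments below perform on a path.
\<close>

lemma vpath_conv_successively:
  "vpath p G \<longleftrightarrow> p \<noteq> [] \<and> set p \<subseteq> verts G \<and> distinct p \<and> successively (dominates G) p"
proof -
  have "set (vwalk_arcs p) \<subseteq> arcs_ends G \<longleftrightarrow> successively (dominates G) p"
    by (induction p rule: vwalk_arcs.induct) auto
  then show ?thesis
    by (auto simp: vpath_def vwalk_def)
qed

lemma longest_path_length_le:
  assumes "longest_path G p" "vpath q G"
  shows "length q \<le> length p"
proof -
  have "vwalk_length q \<le> vwalk_length p" "p \<noteq> []" "q \<noteq> []"
    using assms by (auto simp: longest_path_def vpath_conv_successively simp del: vwalk_length_simp)
  then show ?thesis
    by (cases p; cases q) simp_all
qed

lemma (in graph) longest_path_end_nonadjacent: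
  assumes p: "longest_path G p" and x: "x \<notin> set p"
  shows "\<not> x \<rightarrow>\<^bsub>G\<^esub> hd p" "\<not> x \<rightarrow>\<^bsub>G\<^esub> last p"
proof -
  have path: "vpath p G"
    using p by (simp add: longest_path_def)
  show "\<not> x \<rightarrow>\<^bsub>G\<^esub> hd p"
  proof
    assume "x \<rightarrow>\<^bsub>G\<^esub> hd p"
    then have "vpath (x # p) G"
      using path x by (auto simp: vpath_conv_successively successively_Cons dest: adj_in_verts)
    from longest_path_length_le[OF p this] show False by simp
  qed
  show "\<not> x \<rightarrow>\<^bsub>G\<^esub> last p"
  proof
    assume "x \<rightarrow>\<^bsub>G\<^esub> last p"
    then have "vpath (p @ [x]) G"
      using path x
      by (auto simp: vpath_conv_successively successively_append_iff dominates_sym dest: adj_in_verts)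
    from longest_path_length_le[OF p this] show False by simp
  qed
qed

text \<open>
  Otherwise q could be inserted between B and C. It is applied to a q that consists of one or two
  vertices.
\<close>

lemma (in graph) longest_path_no_detour:
  assumes p: "longest_path G (B @ C)" and BC: "B \<noteq> []" "C \<noteq> []"
    and q: "vpath q G" "set q \<inter> set (B @ C) = {}"
  shows "\<not> (last B \<rightarrow>\<^bsub>G\<^esub> hd q \<and> last q \<rightarrow>\<^bsub>G\<^esub> hd C)"
proof
  assume "last B \<rightarrow>\<^bsub>G\<^esub> hd q \<and> last q \<rightarrow>\<^bsub>G\<^esub> hd C"
  then have "vpath (B @ q @ C) G"
    using p BC q by (auto simp: longest_path_def vpath_conv_successively successively_append_iff)
  from longest_path_length_le[OF p this] q show False
    by (simp add: vpath_conv_successively)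
qed

text \<open>
  Otherwise one could start in x, enter B at its last vertex, traverse it backwards, and jump from
  the first vertex of B to C.
\<close>

lemma (in graph) longest_path_hd_successor_nonadjacent:
  assumes p: "longest_path G (B @ C)" and BC: "B \<noteq> []" "C \<noteq> []"
    and x: "x \<notin> set (B @ C)" "x \<rightarrow>\<^bsub>G\<^esub> last B"
  shows "\<not> hd B \<rightarrow>\<^bsub>G\<^esub> hd C"
proof
  assume "hd B \<rightarrow>\<^bsub>G\<^esub> hd C"
  then have "vpath (x # rev B @ C) G"
    using p BC x
    by (auto simp: longest_path_def vpath_conv_successively successively_append_iff
        successively_Cons hd_rev last_rev dominates_sym dest: adj_in_verts)
  from longest_path_length_le[OF p this] show False by simp
qed

text \<open>
  The obstructions above, collected for an edge from x to the vertex \<open>last B\<close> of the path: x, the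
  first vertex of the path, and the successor \<open>hd C\<close> of \<open>last B\<close> form an independent set.
\<close>

lemma (in graph) longest_path_triple:
  assumes p: "longest_path G (B @ C)" and B: "B \<noteq> []"
    and x: "x \<notin> set (B @ C)" "x \<rightarrow>\<^bsub>G\<^esub> last B"
  shows "C \<noteq> []" "hd B \<noteq> last B" "\<not> x \<rightarrow>\<^bsub>G\<^esub> hd B" "\<not> x \<rightarrow>\<^bsub>G\<^esub> hd C" "\<not> hd B \<rightarrow>\<^bsub>G\<^esub> hd C"
proof -
  show hd: "\<not> x \<rightarrow>\<^bsub>G\<^esub> hd B"
    using longest_path_end_nonadjacent(1)[OF p x(1)] B by simp
  then show "hd B \<noteq> last B"
    using x(2) by auto
  show C: "C \<noteq> []"
    using longest_path_end_nonadjacent(2)[OF p x(1)] x(2) by auto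
  have "vpath [x] G"
    using x by (auto simp: vpath_conv_successively dest: adj_in_verts)
  from longest_path_no_detour[OF p B C this] x show "\<not> x \<rightarrow>\<^bsub>G\<^esub> hd C"
    by (auto simp: dominates_sym)
  show "\<not> hd B \<rightarrow>\<^bsub>G\<^esub> hd C"
    by (rule longest_path_hd_successor_nonadjacent[OF p B C x])
qed

section \<open>Attachments to a longest path in graphs without induced $P_3 + P_1$\<close>

text \<open>
  The vertices x, \<open>last B\<close>, \<open>hd C\<close> span an induced $P_3$, so \<open>hd B\<close> must be adjacent to one of
  them, and \<open>last B\<close> is the only candidate. Then \<open>hd B\<close>, \<open>last B\<close>, \<open>hd C\<close> span an induced
  $P_3$ as well, and a vertex y outside the path cannot be adjacent to the end \<open>hd B\<close>.
\<close>

lemma (in graph) longest_path_attachment: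
  assumes free: "induced_free (with_proj (disjoint_union (path_graph 3) (path_graph 1))) G"
    and p: "longest_path G (B @ C)" and B: "B \<noteq> []"
    and x: "x \<notin> set (B @ C)" "x \<rightarrow>\<^bsub>G\<^esub> last B"
  shows "last B \<rightarrow>\<^bsub>G\<^esub> hd B" "last B \<rightarrow>\<^bsub>G\<^esub> hd C"
    and "\<And>y. y \<in> verts G \<Longrightarrow> y \<notin> set (B @ C) \<Longrightarrow> \<not> y \<rightarrow>\<^bsub>G\<^esub> hd C \<Longrightarrow> y \<rightarrow>\<^bsub>G\<^esub> last B"
proof -
  note t = longest_path_triple[OF p B x]
  have path: "vpath (B @ C) G"
    using p by (simp add: longest_path_def)
  have mem: "hd B \<in> set B" "last B \<in> set B" "hd C \<in> set C"
    using B t(1) by auto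
  have disj: "set B \<inter> set C = {}"
    using path by (auto simp: vpath_conv_successively)
  show link: "last B \<rightarrow>\<^bsub>G\<^esub> hd C"
    using path B t(1) by (auto simp: vpath_conv_successively successively_append_iff)
  have "hd B \<in> verts G"
    using path mem by (auto simp: vpath_conv_successively)
  then have "hd B \<rightarrow>\<^bsub>G\<^esub> x \<or> hd B \<rightarrow>\<^bsub>G\<^esub> last B \<or> hd B \<rightarrow>\<^bsub>G\<^esub> hd C"
    using mem disj x t by (intro induced_P3_dominates[OF free x(2) link t(4)]) auto
  then show hd: "last B \<rightarrow>\<^bsub>G\<^esub> hd B"
    using t by (auto simp: dominates_sym)
  fix y assume y: "y \<in> verts G" "y \<notin> set (B @ C)" "\<not> y \<rightarrow>\<^bsub>G\<^esub> hd C"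
  have "y \<rightarrow>\<^bsub>G\<^esub> hd B \<or> y \<rightarrow>\<^bsub>G\<^esub> last B \<or> y \<rightarrow>\<^bsub>G\<^esub> hd C"
    using mem disj y hd t
    by (intro induced_P3_dominates[OF free _ link t(5)]) (auto simp: dominates_sym)
  moreover have "\<not> y \<rightarrow>\<^bsub>G\<^esub> hd B"
    using longest_path_end_nonadjacent(1)[OF p y(2)] B by simp
  ultimately show "y \<rightarrow>\<^bsub>G\<^esub> last B"
    using y by auto
qed

lemma (in graph) connected_crossing_edge:
  assumes con: "Digraph_Component.connected G"
    and S: "S \<subseteq> verts G" "S \<noteq> {}" and v: "v \<in> verts G" "v \<notin> S"
  obtains x s where "x \<in> verts G" "x \<notin> S" "s \<in> S" "x \<rightarrow>\<^bsub>G\<^esub> s"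
proof -
  obtain s where s: "s \<in> S" "s \<in> verts G"
    using S by auto
  have "strongly_connected G"
    using symmetric_connected_imp_strongly_connected sym_arcs con by blast
  then have "v \<rightarrow>\<^sup>* s"
    using v s by (auto simp: strongly_connected_def)
  then have "v \<in> S \<or> (\<exists>x s. x \<in> verts G \<and> x \<notin> S \<and> s \<in> S \<and> x \<rightarrow>\<^bsub>G\<^esub> s)"
    using s by (induction rule: converse_reachable_induct) (auto dest: adj_in_verts)
  then show thesis
    using v that by blast
qed

lemma split_after_nth:
  assumes "i < length p"
  obtains B C where "p = B @ C" "B \<noteq> []" "last B = p ! i" "length B = Suc i"
    "C \<noteq> [] \<Longrightarrow> hd C = p ! Suc i"
proof
  show "p = take (Suc i) p @ drop (Suc i) p" by simp
qed (use assms in \<open>auto simp: take_Suc_conv_app_nth hd_drop_conv_nth\<close>)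

text \<open>
  Connectedness only gives some vertex x outside p with a neighbour on p. The induced
  $P_3$ that this attachment creates on p makes v adjacent to p as well.
\<close>

lemma (in graph) neighbour_on_longest_path:
  assumes free: "induced_free (with_proj (disjoint_union (path_graph 3) (path_graph 1))) G"
    and con: "Digraph_Component.connected G"
    and p: "longest_path G p" and v: "v \<in> verts G" "v \<notin> set p"
  obtains u where "u \<in> set p" "v \<rightarrow>\<^bsub>G\<^esub> u"
proof -
  have path: "vpath p G"
    using p by (simp add: longest_path_def)
  then obtain x s where x: "x \<notin> set p" "s \<in> set p" "x \<rightarrow>\<^bsub>G\<^esub> s"
    using connected_crossing_edge[OF con _ _ v] unfolding vpath_conv_successively set_empty[symmetric]
    by metis
  then obtain i where i: "i < length p" "s = p ! i"
    by (auto simp: in_set_conv_nth)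
  obtain B C where BC: "p = B @ C" "B \<noteq> []" "last B = p ! i"
    using split_after_nth[OF i(1)] by metis
  have x': "x \<notin> set (B @ C)" "x \<rightarrow>\<^bsub>G\<^esub> last B"
    using x i BC by auto
  have "v \<rightarrow>\<^bsub>G\<^esub> hd C \<or> v \<rightarrow>\<^bsub>G\<^esub> last B"
    using longest_path_attachment(3)[OF free _ BC(2) x'] p v BC(1) by blast
  moreover have "hd C \<in> set p" "last B \<in> set p"
    using longest_path_triple(1)[OF _ BC(2) x'] p BC(1,2) by simp_all
  ultimately show thesis
    using that by blast
qed

text \<open>
  Every neighbour of v contributes a distinct neighbour of u: a neighbour outside p contributes
  itself, a neighbour on p contributes its successor on p. Two neighbours of u are not
  obtained in this way, namely v and the first vertex of p.
\<close>

lemma (in graph) degree_gap_off_longest_path: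
  assumes free: "induced_free (with_proj (disjoint_union (path_graph 3) (path_graph 1))) G"
    and p: "longest_path G p" and v: "v \<notin> set p" and u: "u \<in> set p" "v \<rightarrow>\<^bsub>G\<^esub> u"
  shows "degree G v + 2 \<le> degree G u"
proof -
  have path: "vpath p G"
    using p by (simp add: longest_path_def)
  then have pne: "p \<noteq> []" and dist: "distinct p" and pv: "set p \<subseteq> verts G"
    by (auto simp: vpath_conv_successively)
  define J where "J = {j. j < length p \<and> v \<rightarrow>\<^bsub>G\<^esub> p ! j}"
  define T where "T = (\<lambda>j. p ! Suc j) ` J"
  define W where "W = {w. v \<rightarrow>\<^bsub>G\<^esub> w} - set p"
  \<comment> \<open>No neighbour of v is the last vertex of p, so those on p all have successors.\<close>
  have split: "\<exists>B C. p = B @ C \<and> B \<noteq> [] \<and> last B = p ! j \<and> hd B = hd p \<and> C \<noteq> [] \<and> hd C = p ! Suc j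
      \<and> Suc j < length p" if "j \<in> J" for j
  proof -
    from that have j: "j < length p" "v \<rightarrow>\<^bsub>G\<^esub> p ! j"
      by (auto simp: J_def)
    obtain B C where BC: "p = B @ C" "B \<noteq> []" "last B = p ! j" "length B = Suc j"
      "C \<noteq> [] \<Longrightarrow> hd C = p ! Suc j"
      using split_after_nth[OF j(1)] by metis
    moreover have "C \<noteq> []"
      using longest_path_triple(1)[of B C v] p v j BC by simp
    ultimately show ?thesis
      by (intro exI[of _ B] exI[of _ C]) auto
  qed
  obtain i where i: "i < length p" "u = p ! i"
    using u by (auto simp: in_set_conv_nth)
  then have "i \<in> J"
    using u by (simp add: J_def)
  from split[OF this] obtain B C where BC: "p = B @ C" "B \<noteq> []" "last B = u" "hd B = hd p" "C \<noteq> []"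
    using i by auto
  have vB: "v \<notin> set (B @ C)" "v \<rightarrow>\<^bsub>G\<^esub> last B"
    using v u BC by auto
  have pBC: "longest_path G (B @ C)"
    using p BC by simp
  note triple = longest_path_triple[OF pBC BC(2) vB]
  note attach = longest_path_attachment[OF free pBC BC(2) vB]
  have u_hd: "u \<rightarrow>\<^bsub>G\<^esub> hd p" and v_hd: "\<not> v \<rightarrow>\<^bsub>G\<^esub> hd p"
    using attach(1) triple(3) BC(3,4) by simp_all
  have T: "t \<in> set p \<and> t \<noteq> hd p \<and> \<not> v \<rightarrow>\<^bsub>G\<^esub> t \<and> u \<rightarrow>\<^bsub>G\<^esub> t" if "t \<in> T" for t
  proof -
    from that obtain j where j: "j \<in> J" "t = p ! Suc j"
      by (auto simp: T_def)
    from split[OF j(1)] obtain B' C' where BC': "p = B' @ C'" "B' \<noteq> []" "last B' = p ! j"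
      "hd B' = hd p" "hd C' = t" and lt: "Suc j < length p"
      using j by auto
    have "v \<notin> set (B' @ C')" "v \<rightarrow>\<^bsub>G\<^esub> last B'" "longest_path G (B' @ C')"
      using v p j BC' by (auto simp: J_def)
    note triple' = longest_path_triple[OF this(3) BC'(2) this(1,2)]
    have mem: "t \<in> set p"
      using j lt by simp
    have ne: "t \<noteq> hd p"
      using lt j dist pne by (simp add: hd_conv_nth nth_eq_iff_index_eq)
    \<comment> \<open>v, u, hd p span an induced $P_3$, and t is adjacent to neither of its ends.\<close>
    have "t \<rightarrow>\<^bsub>G\<^esub> v \<or> t \<rightarrow>\<^bsub>G\<^esub> u \<or> t \<rightarrow>\<^bsub>G\<^esub> hd p"
    proof (rule induced_P3_dominates[OF free u(2) u_hd v_hd])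
      show "v \<noteq> hd p" "t \<in> verts G" "t \<noteq> v" "t \<noteq> hd p"
        using v pne mem pv ne by auto
      show "t \<noteq> u"
        using u(2) triple'(4) BC'(5) by auto
    qed
    then show ?thesis
      using mem ne triple'(4,5) BC'(4,5) dominates_sym by metis
  qed
  have W: "u \<rightarrow>\<^bsub>G\<^esub> w" if "w \<in> W" for w
  proof -
    from that have w: "v \<rightarrow>\<^bsub>G\<^esub> w" "w \<notin> set p" "w \<noteq> v"
      using adj_not_same by (auto simp: W_def)
    then have "vpath [v, w] G"
      by (auto simp: vpath_conv_successively dest: adj_in_verts)
    \<comment> \<open>The edge from v to w is a detour between u and its successor.\<close>
    from longest_path_no_detour[OF pBC BC(2,5) this] have "\<not> w \<rightarrow>\<^bsub>G\<^esub> hd C"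
      using v w BC u by (auto simp: dominates_sym)
    then show ?thesis
      using attach(3)[of w] w BC by (auto simp: dominates_sym dest: adj_in_verts)
  qed
  have fin: "finite J" "finite T" "finite W"
    using finite_neighbours by (auto simp: J_def T_def W_def)
  have "inj_on (\<lambda>j. p ! Suc j) J"
    using dist split by (intro inj_onI) (metis nat.inject nth_eq_iff_index_eq)
  then have cT: "card T = card J"
    unfolding T_def by (rule card_image)
  have "inj_on (\<lambda>j. p ! j) J"
    using dist by (auto intro!: inj_onI simp: J_def nth_eq_iff_index_eq)
  then have "card ((\<lambda>j. p ! j) ` J) = card J"
    by (rule card_image)
  moreover have "{w. v \<rightarrow>\<^bsub>G\<^esub> w} = W \<union> (\<lambda>j. p ! j) ` J"
    by (auto simp: W_def J_def in_set_conv_nth image_iff)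
  moreover have "W \<inter> (\<lambda>j. p ! j) ` J = {}"
    by (auto simp: W_def J_def)
  ultimately have "degree G v = card W + card T"
    using fin cT by (simp add: degree_conv_card_neighbours card_Un_disjoint)
  also have "\<dots> + 2 = card ({v, hd p} \<union> (W \<union> T))"
  proof -
    have "v \<noteq> hd p" "v \<notin> W \<union> T" "hd p \<notin> W \<union> T"
      using v pne T adj_not_same by (auto simp: W_def)
    moreover have "W \<inter> T = {}"
      using T by (auto simp: W_def)
    ultimately show ?thesis
      using fin by (simp add: card_Un_disjoint)
  qed
  also have "\<dots> \<le> card {w. u \<rightarrow>\<^bsub>G\<^esub> w}"
    using T W u u_hd by (intro card_mono finite_neighbours) (auto simp: dominates_sym)
  finally show ?thesis
    by (simp add: degree_conv_card_neighbours)
qed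

theorem theorem6:
  fixes G :: "('a, 'b) pre_digraph" and v :: 'a
  assumes "graph G"
    and "Digraph_Component.connected G"
    and "induced_free (with_proj (disjoint_union (path_graph 3) (path_graph 1))) G"
    and "v \<in> verts G"
    and "degree G v \<ge> max_degree G - 1"
  shows "gallai_vertex G v"
proof -
  interpret graph G by fact
  have "v \<in> set p" if p: "longest_path G p" for p
  proof (rule ccontr)
    assume v: "v \<notin> set p"
    obtain u where u: "u \<in> set p" "v \<rightarrow>\<^bsub>G\<^esub> u"
      using neighbour_on_longest_path[OF assms(3,2) p assms(4) v] by blast
    then have "degree G v + 2 \<le> degree G u"
      by (rule degree_gap_off_longest_path[OF assms(3) p v])
    moreover have "degree G u \<le> max_degree G"
      using u by (intro degree_le_max_degree adj_in_verts(2))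
    ultimately show False
      using assms(5) by simp
  qed
  then show ?thesis
    using assms(4) by (simp add: gallai_vertex_def)
qed

end
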